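(* Let $L$ be a Tonelli Lagrangian on $\mathbb T^d$, let $\tau_0>0$ and let $\eta_0>0$ be fixed. Then there exist constants $C,D>0$, independent of $h$ and $\tau$, such that for all mesh sizes $h$ and time steps $\tau$ with $0<\tau\le\tau_0$ and $h\le\eta_0\tau$, every $u_{h,\tau}:\mathcal G_h\to\mathbb R$ solving $$u_{h,\tau}(x_j)+\tau\bar L(h,\tau)=(T_{h,\tau}u_{h,\tau})(x_j)\qquad\forall x_j\in\mathcal G_h$$ satisfies $$|u_{h,\tau}(x_i)-u_{h,\tau}(x_j)|\le C\,d_{\mathbb T^d}(x_i,x_j),\qquad x_i,x_j\in\mathcal G_h.$$ Moreover, if $x_j\in\mathcal G_h$ and $(x_i,\ell)\in\mathcal G_h\times\mathbb Z^d$ realizes the minimum defining $(T_{h,\tau}u_{h,\tau})(x_j)$, i.e. $$u_{h,\tau}(x_j)+\tau\bar L(h,\tau)=u_{h,\tau}(x_i)+\tau L\Big(x_i,\frac{x_j+\ell-x_i}{\tau}\Big),$$ then $$\Big|\frac{x_j+\ell-x_i}{\tau}\Big|\le D.$$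
   Context: $\mathbb T^d=\mathbb R^d/\mathbb Z^d$ with its flat distance $d_{\mathbb T^d}$. $H\in C^2(\mathbb T^d\times\mathbb R^d)$ is a Tonelli Hamiltonian: $D^2_{pp}H(x,p)>0$ everywhere and $H$ is superlinear in $p$. The Tonelli Lagrangian is $L(x,v)=\sup_{p\in\mathbb R^d}\{p\cdot v-H(x,p)\}$; it is of class $C^2$, strictly convex in $v$, and superlinear: for every $K>0$ there is $C(K)\in\mathbb R$ with $L(x,v)\ge K|v|-C(K)$ for all $(x,v)$. Mesh sizes are always of the form $h=1/N$ with $N\ge1$ an integer. The grid is $\mathcal G_h=\{x_i=ih \bmod \mathbb Z^d: i\in\{0,\dots,N-1\}^d\}$, and each grid point is identified with its representative in $[0,1)^d$. The fully-discrete Lax–Oleinik operator acts on $u_h:\mathcal G_h\to\mathbb R$ by $$(T_{h,\tau}u_h)(x_j)=\min_{x_i\in\mathcal G_h,\ \ell\in\mathbb Z^d}\Big\{u_h(x_i)+\tau L\Big(x_i,\frac{x_j+\ell-x_i}{\tau}\Big)\Big\},\qquad x_j\in\mathcal G_h;$$ the minimum is attained. $\bar L(h,\tau)\in\mathbb R$ is the unique constant for which the equation $T_{h,\tau}u=u+\tau\bar L(h,\tau)$ has a solution $u:\mathcal G_h\to\mathbb R$. *)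

theory Defs
  imports "HOL-Analysis.Analysis"
begin

text \<open>
  Functions on the torus are represented by functions on \<open>real ^ 'n\<close> that are periodic with
  respect to the integer lattice; the dimension is \<open>CARD('n)\<close>.
\<close>

definition int_lattice :: "(real ^ 'n) set" where
  "int_lattice = {l. \<forall>k. l $ k \<in> \<int>}"

definition torus_dist :: "real ^ 'n \<Rightarrow> real ^ 'n \<Rightarrow> real" where
  "torus_dist x y = (INF l\<in>int_lattice. dist x (y + l))"

definition C2 :: "('a::real_normed_vector \<Rightarrow> 'b::real_normed_vector) \<Rightarrow> bool" where
  "C2 f \<longleftrightarrow>
    (\<exists>(f' :: 'a \<Rightarrow> 'a \<Rightarrow>\<^sub>L 'b) (f'' :: 'a \<Rightarrow> 'a \<Rightarrow>\<^sub>L ('a \<Rightarrow>\<^sub>L 'b)).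
      (\<forall>z. (f has_derivative blinfun_apply (f' z)) (at z)) \<and>
      (\<forall>z. (f' has_derivative blinfun_apply (f'' z)) (at z)) \<and>
      continuous_on UNIV f'')"

text \<open>
  The nested Frechet derivative in the third clause is the Hessian of \<open>H x\<close> at \<open>p\<close> evaluated on
  \<open>(w, w)\<close>, so this clause says that it is positive definite.
  Superlinearity is uniform in \<open>x\<close>.
\<close>

definition tonelli_hamiltonian :: "(real ^ 'n \<Rightarrow> real ^ 'n \<Rightarrow> real) \<Rightarrow> bool" where
  "tonelli_hamiltonian H \<longleftrightarrow>
    (\<forall>x p. \<forall>l\<in>int_lattice. H (x + l) p = H x p) \<and>
    C2 (\<lambda>(x, p). H x p) \<and>
    (\<forall>x p w. w \<noteq> 0 \<longrightarrow>
      frechet_derivative (\<lambda>q. frechet_derivative (H x) (at q) w) (at p) w > 0) \<and>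
    (\<forall>K>0. \<exists>C. \<forall>x p. H x p \<ge> K * norm p - C)"

definition legendre :: "(real ^ 'n \<Rightarrow> real ^ 'n \<Rightarrow> real) \<Rightarrow> real ^ 'n \<Rightarrow> real ^ 'n \<Rightarrow> real" where
  "legendre H x v = (SUP p. p \<bullet> v - H x p)"

definition tonelli_lagrangian :: "(real ^ 'n \<Rightarrow> real ^ 'n \<Rightarrow> real) \<Rightarrow> bool" where
  "tonelli_lagrangian L \<longleftrightarrow> (\<exists>H. tonelli_hamiltonian H \<and> L = legendre H)"

text \<open>
  The grid and the operators below are indexed by \<open>N\<close>, for the mesh size \<open>h = 1 / N\<close>. Grid points
  are given by their representatives in the half-open unit cube. A grid function is a function on
  \<open>real ^ 'n\<close> of which only the values on the grid are used.
\<close>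

definition grid :: "nat \<Rightarrow> (real ^ 'n) set" where
  "grid N = {x. \<exists>i :: 'n \<Rightarrow> nat. (\<forall>k. i k < N) \<and> x = (\<chi> k. real (i k) * (1 / real N))}"

text \<open>
  For a Tonelli Lagrangian, \<open>N \<ge> 1\<close> and \<open>\<tau> > 0\<close>, the infimum is attained, by superlinearity.
\<close>

definition lax_oleinik ::
  "(real ^ 'n \<Rightarrow> real ^ 'n \<Rightarrow> real) \<Rightarrow> nat \<Rightarrow> real \<Rightarrow> (real ^ 'n \<Rightarrow> real) \<Rightarrow> real ^ 'n \<Rightarrow> real" where
  "lax_oleinik L N \<tau> u y =
    (INF (x, l) \<in> grid N \<times> int_lattice. u x + \<tau> * L x ((y + l - x) /\<^sub>R \<tau>))"

definition Lbar :: "(real ^ 'n \<Rightarrow> real ^ 'n \<Rightarrow> real) \<Rightarrow> nat \<Rightarrow> real \<Rightarrow> real" where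
  "Lbar L N \<tau> = (THE c. \<exists>u. \<forall>y\<in>grid N. lax_oleinik L N \<tau> u y = u y + \<tau> * c)"

end

theory Submission
  imports Defs
begin

text \<open>
  The constant \<open>Lbar L N \<tau>\<close> lies between bounds on \<open>L\<close>, as one sees by evaluating the equation at
  a minimum point of \<open>u\<close> and by standing still. A chain of grid points with velocities of order
  one gives \<open>u y - u x \<le> K * \<bar>y - x\<bar>\<close> at distances of at least \<open>\<tau>\<close>; this is where
  \<open>h \<le> \<eta>\<^sub>0 * \<tau>\<close> enters. Superlinearity of \<open>L\<close> with slope \<open>K + 1\<close> then bounds the velocities of
  minimizers. At distances below \<open>\<tau>\<close> one compares with the minimizer of the other point, and the
  Lipschitz bound comes from the local Lipschitz continuity of the convex function \<open>L x\<close>.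
\<close>

section \<open>Tonelli Lagrangians\<close>

lemma int_lattice_zero: "0 \<in> int_lattice"
  and int_lattice_diff: "a \<in> int_lattice \<Longrightarrow> b \<in> int_lattice \<Longrightarrow> a - b \<in> int_lattice"
  by (auto simp: int_lattice_def)

text \<open>The representative in the half-open unit cube. Composing with it extends grid functions
  periodically, and it reduces suprema over the torus to a compact cube.\<close>

definition frac_vec :: "real ^ 'n \<Rightarrow> real ^ 'n" where
  "frac_vec z = (\<chi> k. frac (z $ k))"

lemma diff_frac_vec_lattice: "z - frac_vec z \<in> int_lattice"
  by (auto simp: int_lattice_def frac_vec_def frac_def)

lemma frac_vec_add_lattice:
  assumes "l \<in> int_lattice"
  shows "frac_vec (z + l) = frac_vec z"
proof -
  have "frac (z $ k + l $ k) = frac (z $ k)" for k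
    using assms by (auto simp: int_lattice_def frac_def elim!: Ints_cases dest!: spec[of _ k])
  then show ?thesis
    by (simp add: frac_vec_def)
qed

lemma frac_vec_in_cbox: "frac_vec z \<in> cbox 0 (\<chi> k. 1)"
  by (auto simp: mem_box_cart frac_vec_def frac_ge_0 less_imp_le[OF frac_lt_1])

text \<open>Superlinearity of \<open>H\<close> with slope \<open>\<bar>R\<bar> + 1\<close> absorbs
  the linear term by Cauchy-Schwarz. It is uniform in the base point, hence so is
  \<open>A\<close>.\<close>

lemma legendre_bounds:
  assumes "tonelli_hamiltonian H"
  obtains A where "\<And>x v p. norm v \<le> R \<Longrightarrow> p \<bullet> v - H x p \<le> A"
proof -
  from assms obtain A where A: "\<And>x p. H x p \<ge> (\<bar>R\<bar> + 1) * norm p - A"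
    unfolding tonelli_hamiltonian_def by (metis abs_ge_zero add_nonneg_pos zero_less_one)
  show ?thesis
  proof (rule that[of A])
    fix x v p :: "real ^ 'a" assume v: "norm v \<le> R"
    have "p \<bullet> v \<le> norm p * norm v" by (rule norm_cauchy_schwarz)
    also have "\<dots> \<le> norm p * (\<bar>R\<bar> + 1)" using v by (intro mult_left_mono) auto
    finally show "p \<bullet> v - H x p \<le> A" using A[where x=x and p=p] by (simp add: mult.commute)
  qed
qed

lemma legendre_bdd_above:
  assumes "tonelli_hamiltonian H"
  shows "bdd_above (range (\<lambda>p. p \<bullet> v - H x p))"
proof -
  obtain A where "\<And>x w p. norm w \<le> norm v \<Longrightarrow> p \<bullet> w - H x p \<le> A"
    using legendre_bounds[OF assms] by blast
  then show ?thesis by (intro bdd_aboveI[of _ A]) auto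
qed

lemma legendre_ge:
  assumes "tonelli_hamiltonian H"
  shows "p \<bullet> v - H x p \<le> legendre H x v"
  unfolding legendre_def by (rule cSUP_upper[OF UNIV_I legendre_bdd_above[OF assms]])

lemma tonelli_lagrangian_add_lattice:
  assumes "tonelli_lagrangian L" "l \<in> int_lattice"
  shows "L (x + l) = L x"
  using assms by (auto simp: tonelli_lagrangian_def tonelli_hamiltonian_def legendre_def fun_eq_iff)

lemma tonelli_lagrangian_upper:
  assumes "tonelli_lagrangian L"
  obtains A where "\<And>x v. norm v \<le> R \<Longrightarrow> L x v \<le> A"
proof -
  from assms obtain H where H: "tonelli_hamiltonian H" and L: "L = legendre H"
    by (auto simp: tonelli_lagrangian_def)
  obtain A where A: "\<And>x v p. norm v \<le> R \<Longrightarrow> p \<bullet> v - H x p \<le> A"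
    using legendre_bounds[OF H] by blast
  show ?thesis
    by (rule that[of A]) (auto simp: L legendre_def intro!: cSUP_least A)
qed

text \<open>A continuous function is bounded on the compact product of the unit cube and a ball;
  periodicity moves every base point into the cube.\<close>

lemma tonelli_hamiltonian_locally_bounded:
  fixes H :: "real ^ 'n \<Rightarrow> real ^ 'n \<Rightarrow> real"
  assumes "tonelli_hamiltonian H"
  obtains B where "\<And>x p. norm p \<le> K \<Longrightarrow> H x p \<le> B"
proof -
  from assms obtain f' where
    "\<And>z. ((\<lambda>(x, p). H x p) has_derivative blinfun_apply (f' z)) (at z)"
    unfolding tonelli_hamiltonian_def C2_def by blast
  then have "continuous_on UNIV (\<lambda>(x, p). H x p)"
    by (intro continuous_at_imp_continuous_on ballI) (rule has_derivative_continuous)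
  then have "compact ((\<lambda>(x, p). H x p) ` (cbox 0 (\<chi> k. 1) \<times> cball 0 K))"
    by (intro compact_continuous_image compact_Times compact_cbox compact_cball)
      (rule continuous_on_subset, auto)
  then obtain B where B: "\<And>x p. x \<in> cbox 0 (\<chi> k. 1) \<Longrightarrow> p \<in> cball 0 K \<Longrightarrow> \<bar>H x p\<bar> \<le> B"
    by (fastforce dest!: compact_imp_bounded simp: bounded_iff)
  show ?thesis
  proof (rule that[of B])
    fix x p :: "real ^ 'n" assume "norm p \<le> K"
    have "H (frac_vec x + (x - frac_vec x)) p = H (frac_vec x) p"
      using assms diff_frac_vec_lattice[of x] unfolding tonelli_hamiltonian_def by blast
    moreover have "\<bar>H (frac_vec x) p\<bar> \<le> B"
      using B[OF frac_vec_in_cbox, of p x] \<open>norm p \<le> K\<close> by simp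
    ultimately show "H x p \<le> B" by simp
  qed
qed

text \<open>Fenchel's inequality is tested with \<open>K *\<^sub>R sgn v\<close>, and
  \<open>B\<close> bounds \<open>H\<close> on the ball of such momenta. The case
  \<open>K = 0\<close> serves as a uniform lower bound for \<open>L\<close>.\<close>

lemma tonelli_lagrangian_superlinear:
  fixes L :: "real ^ 'n \<Rightarrow> real ^ 'n \<Rightarrow> real"
  assumes "tonelli_lagrangian L" "K \<ge> 0"
  obtains B where "\<And>x v. K * norm v - B \<le> L x v"
proof -
  from assms obtain H where H: "tonelli_hamiltonian H" and L: "L = legendre H"
    by (auto simp: tonelli_lagrangian_def)
  obtain B where B: "\<And>x p. norm p \<le> K \<Longrightarrow> H x p \<le> B"
    using tonelli_hamiltonian_locally_bounded[OF H] by blast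
  show ?thesis
  proof (rule that[of B])
    fix x v :: "real ^ 'n"
    let ?p = "K *\<^sub>R sgn v"
    have p: "norm ?p \<le> K" using assms(2) by (simp add: norm_sgn)
    have "sgn v \<bullet> v = norm v"
      by (cases "v = 0") (simp_all add: sgn_div_norm dot_square_norm power2_eq_square)
    then have "?p \<bullet> v = K * norm v" by simp
    with p show "K * norm v - B \<le> L x v"
      using legendre_ge[OF H, of ?p v x] B[of ?p x] unfolding L by linarith
  qed
qed

text \<open>A supremum of functions affine in the velocity is convex.\<close>

lemma tonelli_lagrangian_convex:
  assumes "tonelli_lagrangian L" "0 \<le> t" "t \<le> 1"
  shows "L x ((1 - t) *\<^sub>R v + t *\<^sub>R w) \<le> (1 - t) * L x v + t * L x w"
proof -
  from assms obtain H where H: "tonelli_hamiltonian H" and L: "L = legendre H"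
    by (auto simp: tonelli_lagrangian_def)
  have "p \<bullet> ((1 - t) *\<^sub>R v + t *\<^sub>R w) - H x p \<le> (1 - t) * L x v + t * L x w" for p
  proof -
    have "p \<bullet> ((1 - t) *\<^sub>R v + t *\<^sub>R w) - H x p = (1 - t) * (p \<bullet> v - H x p) + t * (p \<bullet> w - H x p)"
      by (simp add: inner_right_distrib algebra_simps)
    also have "\<dots> \<le> (1 - t) * L x v + t * L x w"
      using assms(2,3) by (intro add_mono mult_left_mono) (auto simp: L legendre_ge[OF H])
    finally show ?thesis .
  qed
  then show ?thesis by (auto simp: L legendre_def intro!: cSUP_least)
qed

text \<open>A convex function bounded on a ball is Lipschitz on the concentric ball whose radius is
  smaller by one. The bounds \<open>A\<close> and \<open>B\<close> are uniform in \<open>x\<close>,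
  so \<open>Q\<close> is too.\<close>

lemma tonelli_lagrangian_lipschitz:
  fixes L :: "real ^ 'n \<Rightarrow> real ^ 'n \<Rightarrow> real"
  assumes L: "tonelli_lagrangian L"
  obtains Q where "Q \<ge> 0"
    "\<And>x v w. norm v \<le> R \<Longrightarrow> norm w \<le> R \<Longrightarrow> L x w - L x v \<le> Q * norm (w - v)"
proof -
  obtain A where A: "\<And>x v. norm v \<le> R + 1 \<Longrightarrow> L x v \<le> A"
    using tonelli_lagrangian_upper[OF L] by blast
  obtain B where B: "\<And>x v. 0 * norm v - B \<le> L x v"
    using tonelli_lagrangian_superlinear[OF L order_refl] by blast
  show ?thesis
  proof (rule that[of "\<bar>A + B\<bar>"])
    fix x v w :: "real ^ 'n" assume v: "norm v \<le> R" and w: "norm w \<le> R"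
    \<comment> \<open>The segment from \<open>v\<close> to \<open>w\<close> is prolonged beyond
      \<open>w\<close> by unit length to \<open>z\<close>, so that \<open>w\<close> divides it with
      weight \<open>t \<le> r\<close>. For \<open>v = w\<close> the prolongation is zero because
      \<open>sgn 0 = 0\<close>.\<close>
    define r where "r = norm (w - v)"
    define z where "z = w + sgn (w - v)"
    define t where "t = r / (1 + r)"
    have r: "r \<ge> 0" by (simp add: r_def)
    then have t: "0 \<le> t" "t \<le> 1" "t \<le> r"
      by (auto simp: t_def field_simps)
    have "w = (1 - t) *\<^sub>R v + t *\<^sub>R z"
    proof -
      have "t *\<^sub>R (z - w) = (1 - t) *\<^sub>R (w - v)"
      proof (cases "r = 0")
        case True
        then show ?thesis by (simp add: t_def r_def)
      next
        case False
        then show ?thesis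
          using r by (simp add: z_def t_def sgn_div_norm r_def[symmetric] field_simps)
      qed
      then show ?thesis by (simp add: algebra_simps)
    qed
    then have "L x w \<le> (1 - t) * L x v + t * L x z"
      using tonelli_lagrangian_convex[OF L t(1,2)] by metis
    then have "L x w - L x v \<le> t * (L x z - L x v)" by (simp add: algebra_simps)
    also have "\<dots> \<le> t * \<bar>A + B\<bar>"
    proof (intro mult_left_mono t(1))
      have "norm z \<le> R + 1"
        unfolding z_def by (intro norm_triangle_le add_mono w) (simp add: norm_sgn)
      then show "L x z - L x v \<le> \<bar>A + B\<bar>" using A[of z x] B[of v x] by simp
    qed
    also have "\<dots> \<le> \<bar>A + B\<bar> * r" using mult_left_mono[OF t(3), of "\<bar>A + B\<bar>"] by (simp add: mult.commute)
    finally show "L x w - L x v \<le> \<bar>A + B\<bar> * norm (w - v)" by (simp add: r_def)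
  qed simp
qed

section \<open>The scaled integer lattice\<close>

text \<open>For \<open>N \<ge> 1\<close> this is the lift of the grid to the whole space, with mesh
  \<open>1 / N\<close>. Segments and chains of points can be used here without regard to the
  torus.\<close>

definition scaled_lattice :: "nat \<Rightarrow> (real ^ 'n) set" where
  "scaled_lattice N = {z. \<forall>k. real N * z $ k \<in> \<int>}"

lemma scaled_lattice_add: "a \<in> scaled_lattice N \<Longrightarrow> b \<in> scaled_lattice N \<Longrightarrow> a + b \<in> scaled_lattice N"
  and int_lattice_subset_scaled: "int_lattice \<subseteq> scaled_lattice N"
  by (auto simp: scaled_lattice_def int_lattice_def algebra_simps)

lemma grid_subset_scaled: "grid N \<subseteq> scaled_lattice N"
  by (auto simp: grid_def scaled_lattice_def)

lemma frac_vec_grid: "x \<in> grid N \<Longrightarrow> frac_vec x = x"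
  by (auto simp: grid_def frac_vec_def vec_eq_iff frac_eq divide_less_eq)

lemma frac_vec_in_grid:
  assumes "z \<in> scaled_lattice N" "N \<ge> 1"
  shows "frac_vec z \<in> grid N"
proof -
  define i where "i = (\<lambda>k. nat \<lfloor>real N * frac (z $ k)\<rfloor>)"
  have "real (i k) = real N * frac (z $ k)" for k
  proof -
    have "real N * frac (z $ k) \<in> \<int>"
      using assms(1) by (auto simp: scaled_lattice_def frac_def right_diff_distrib)
    then show ?thesis
      unfolding i_def by (subst of_nat_nat) (auto simp: frac_ge_0 elim: Ints_cases)
  qed
  moreover from this have "i k < N" for k
    using frac_lt_1[of "z $ k"] assms(2)
    by (metis mult.right_neutral mult_less_cancel_left_pos of_nat_0_less_iff of_nat_less_iff
        less_le_trans zero_less_one)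
  ultimately show ?thesis
    using assms(2) unfolding grid_def by (auto simp: frac_vec_def vec_eq_iff intro!: exI[of _ i])
qed

lemma finite_grid: "finite (grid N)"
proof -
  have "grid N = (\<lambda>i. \<chi> k. real (i k) * (1 / real N)) ` {i. range i \<subseteq> {..<N}}"
    unfolding grid_def by (fastforce simp: image_iff)
  moreover have "finite {i :: 'a \<Rightarrow> nat. range i \<subseteq> {..<N}}"
    using finite_PiE[of "UNIV :: 'a set" "\<lambda>_. {..<N}"]
    by (simp add: PiE_UNIV_domain Pi_def image_subset_iff)
  ultimately show ?thesis by (metis finite_imageI)
qed

lemma grid_zero: "N \<ge> 1 \<Longrightarrow> 0 \<in> grid N"
  by (auto simp: grid_def vec_eq_iff intro!: exI[of _ "\<lambda>_. 0"])

lemma grid_times_lattice_nonempty: "N \<ge> 1 \<Longrightarrow> grid N \<times> int_lattice \<noteq> {}"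
  using grid_zero int_lattice_zero by (metis SigmaI empty_iff)

text \<open>Controls rounding: an error \<open>e\<close> in each coordinate costs at most its l1
  norm, whence the factor \<open>CARD('n)\<close>.\<close>

lemma norm_le_coordinate_bound:
  fixes w z :: "real ^ 'n"
  assumes "\<And>k. \<bar>w $ k\<bar> \<le> \<bar>z $ k\<bar> + e" "e \<ge> 0"
  shows "norm w \<le> norm z + real CARD('n) * e"
proof -
  have "norm w \<le> norm ((\<chi> k. \<bar>z $ k\<bar>) + (\<chi> k. e) :: real ^ 'n)"
    using assms by (intro norm_le_componentwise_cart) (auto intro: order_trans[OF _ abs_ge_self])
  also have "\<dots> \<le> norm (\<chi> k. \<bar>z $ k\<bar>) + norm (\<chi> k. e :: real ^ 'n)"
    by (rule norm_triangle_ineq)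
  also have "norm (\<chi> k. \<bar>z $ k\<bar>) = norm z" by (simp add: norm_vec_def)
  also have "norm (\<chi> k. e :: real ^ 'n) \<le> real CARD('n) * e"
    using norm_le_l1_cart[of "\<chi> k. e :: real ^ 'n"] assms(2) by simp
  finally show ?thesis by simp
qed

section \<open>Weak KAM inequalities on the scaled lattice\<close>

text \<open>
  The segment from \<open>a\<close> to \<open>b\<close> is rounded to a chain of lattice points whose consecutive
  distances are of order \<open>\<tau>\<close>, so that each step costs at most \<open>\<tau> * M\<close>.
\<close>

lemma subsolution_coarse_lipschitz:
  fixes U :: "real ^ 'n \<Rightarrow> real"
  assumes sub: "\<And>a b. a \<in> scaled_lattice N \<Longrightarrow> b \<in> scaled_lattice N \<Longrightarrow>
      U b + \<tau> * c \<le> U a + \<tau> * L a ((b - a) /\<^sub>R \<tau>)"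
    and M: "\<And>x v. norm v \<le> 1 + real CARD('n) * \<eta> \<Longrightarrow> L x v - c \<le> M" "M \<ge> 0"
    and N: "N \<ge> 1" "0 < \<tau>" "1 / real N \<le> \<eta> * \<tau>"
    and ab: "a \<in> scaled_lattice N" "b \<in> scaled_lattice N" "\<tau> \<le> norm (b - a)"
  shows "U b - U a \<le> 2 * M * norm (b - a)"
proof -
  \<comment> \<open>Rounding up makes each of the \<open>n\<close> pieces at most
    \<open>\<tau>\<close> long; as the quotient is at least one, rounding at most doubles it, which
    gives the factor 2 in the conclusion.\<close>
  define n where "n = nat \<lceil>norm (b - a) / \<tau>\<rceil>"
  define z :: "nat \<Rightarrow> real ^ 'n" where
    "z = (\<lambda>i. \<chi> k. of_int \<lfloor>real N * (a $ k + real i / real n * (b - a) $ k)\<rfloor> / real N)"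
  have one: "1 \<le> norm (b - a) / \<tau>" using N(2) ab(3) by simp
  have "real n = of_int \<lceil>norm (b - a) / \<tau>\<rceil>" using one by (simp add: n_def)
  then have n: "norm (b - a) / \<tau> \<le> real n" "real n \<le> 2 * (norm (b - a) / \<tau>)"
    using one by linarith+
  then have n0: "real n > 0" using one by linarith
  have z_in: "z i \<in> scaled_lattice N" for i
    using N(1) by (simp add: z_def scaled_lattice_def)
  have step: "U (z (Suc i)) - U (z i) \<le> \<tau> * M" for i
  proof -
    have "norm (z (Suc i) - z i) \<le> norm ((1 / real n) *\<^sub>R (b - a)) + real CARD('n) * (1 / real N)"
    proof (rule norm_le_coordinate_bound)
      fix k
      define s where "s = real N * (a $ k + real i / real n * (b - a) $ k)"
      define s' where "s' = real N * (a $ k + real (Suc i) / real n * (b - a) $ k)"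
      \<comment> \<open>The extra 1 from the two floors becomes one mesh size after division by
        \<open>N\<close>.\<close>
      have "\<bar>of_int \<lfloor>s'\<rfloor> - of_int \<lfloor>s\<rfloor>\<bar> \<le> \<bar>s' - s\<bar> + 1" by linarith
      moreover have "s' - s = real N * ((1 / real n) *\<^sub>R (b - a)) $ k"
        using n0 by (simp add: s_def s'_def field_simps)
      then have "\<bar>s' - s\<bar> = real N * \<bar>((1 / real n) *\<^sub>R (b - a)) $ k\<bar>"
        by (simp only: abs_mult abs_of_nat)
      ultimately have "\<bar>of_int \<lfloor>s'\<rfloor> - of_int \<lfloor>s\<rfloor>\<bar> / real N \<le> \<bar>((1 / real n) *\<^sub>R (b - a)) $ k\<bar> + 1 / real N"
        using N(1) by (simp only: divide_le_eq) (simp add: distrib_left distrib_right mult.commute)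
      moreover have "(z (Suc i) - z i) $ k = (of_int \<lfloor>s'\<rfloor> - of_int \<lfloor>s\<rfloor>) / real N"
        by (simp add: z_def s_def s'_def diff_divide_distrib)
      ultimately show "\<bar>(z (Suc i) - z i) $ k\<bar> \<le> \<bar>((1 / real n) *\<^sub>R (b - a)) $ k\<bar> + 1 / real N"
        by simp
    qed simp
    also have "norm ((1 / real n) *\<^sub>R (b - a)) = norm (b - a) / real n" by simp
    also have "\<dots> \<le> \<tau>"
      using n(1) n0 N(2) by (simp add: field_simps)
    \<comment> \<open>The mesh condition turns the rounding error into a multiple of
      \<open>\<tau>\<close>, so the speed of a step stays bounded independently of \<open>N\<close>
      and \<open>\<tau>\<close>.\<close>
    also have "real CARD('n) * (1 / real N) \<le> real CARD('n) * (\<eta> * \<tau>)"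
      using N(3) by (intro mult_left_mono) auto
    finally have "norm (z (Suc i) - z i) \<le> (1 + real CARD('n) * \<eta>) * \<tau>"
      by (simp add: algebra_simps)
    then have "norm ((z (Suc i) - z i) /\<^sub>R \<tau>) \<le> 1 + real CARD('n) * \<eta>"
      using N(2) by (simp add: divide_le_eq flip: divide_inverse_commute)
    then have "\<tau> * (L (z i) ((z (Suc i) - z i) /\<^sub>R \<tau>) - c) \<le> \<tau> * M"
      using N(2) M(1) by (intro mult_left_mono) auto
    then show ?thesis
      using sub[OF z_in z_in, of "Suc i" i] by (simp add: algebra_simps)
  qed
  have "U (z m) - U (z 0) \<le> real m * (\<tau> * M)" for m
  proof (induction m)
    case (Suc m)
    then show ?case using step[of m] by (simp add: algebra_simps)
  qed simp
  \<comment> \<open>Rounding fixes both ends, since they lie on the scaled lattice.\<close>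
  moreover have "z 0 = a" "z n = b"
    using ab(1,2) n0 N(1) by (auto simp: z_def vec_eq_iff scaled_lattice_def elim!: Ints_cases dest!: spec)
  ultimately have "U b - U a \<le> real n * (\<tau> * M)" by metis
  also have "\<dots> \<le> 2 * (norm (b - a) / \<tau>) * (\<tau> * M)"
    using n(2) N(2) M(2) by (intro mult_right_mono) auto
  finally show ?thesis using N(2) by (simp add: field_simps)
qed

text \<open>Over distances of at least \<open>\<tau>\<close> the gain in \<open>U\<close> has slope
  at most \<open>K\<close>, while the action grows with slope \<open>K + 1\<close>; the surplus
  slope bounds the speed. The slack \<open>\<tau>\<close> in \<open>min\<close> admits almost
  minimizers and contributes the final 1 after division by \<open>\<tau>\<close>.\<close>

lemma minimizer_speed_bound:
  fixes U :: "real ^ 'n \<Rightarrow> real"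
  assumes coarse: "\<tau> \<le> norm (b - a) \<Longrightarrow> U b - U a \<le> K * norm (b - a)"
    and superlinear: "\<And>x v. (K + 1) * norm v - B \<le> L x v"
    and \<tau>: "0 < \<tau>" and c: "c \<le> A"
    and min: "U a + \<tau> * L a ((b - a) /\<^sub>R \<tau>) \<le> U b + \<tau> * c + \<tau>"
  shows "norm ((b - a) /\<^sub>R \<tau>) \<le> max 1 (A + B + 1)"
proof (cases "\<tau> \<le> norm (b - a)")
  case True
  define r where "r = norm ((b - a) /\<^sub>R \<tau>)"
  have r: "norm (b - a) = \<tau> * r" using \<tau> by (simp add: r_def)
  have "\<tau> * ((K + 1) * r - B) \<le> \<tau> * L a ((b - a) /\<^sub>R \<tau>)"
    using superlinear[of "(b - a) /\<^sub>R \<tau>" a] \<tau> by (simp add: r_def)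
  also have "\<dots> \<le> K * (\<tau> * r) + \<tau> * c + \<tau>"
    using coarse[OF True] min by (simp add: r)
  also have "\<dots> = \<tau> * (K * r + c + 1)" by (simp add: algebra_simps)
  finally have "(K + 1) * r - B \<le> K * r + c + 1" using \<tau> by simp
  then show ?thesis using c by (simp add: r_def algebra_simps)
next
  case False
  then have "norm ((b - a) /\<^sub>R \<tau>) \<le> 1" using \<tau> by (simp add: divide_le_eq flip: divide_inverse_commute)
  then show ?thesis by simp
qed

text \<open>
  For nearby points the almost minimizer of \<open>a\<close> is a competitor for \<open>b\<close>; almost minimizers
  suffice, so attainment of the infimum in the Lax-Oleinik operator is never used.
\<close>

lemma solution_fine_lipschitz:
  fixes U :: "real ^ 'n \<Rightarrow> real"
  assumes sub: "\<And>a b. a \<in> scaled_lattice N \<Longrightarrow> b \<in> scaled_lattice N \<Longrightarrow>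
      U b + \<tau> * c \<le> U a + \<tau> * L a ((b - a) /\<^sub>R \<tau>)"
    and super: "\<And>b e. b \<in> scaled_lattice N \<Longrightarrow> 0 < e \<Longrightarrow>
      \<exists>a\<in>scaled_lattice N. U a + \<tau> * L a ((b - a) /\<^sub>R \<tau>) \<le> U b + \<tau> * c + e"
    and speed: "\<And>a b. a \<in> scaled_lattice N \<Longrightarrow> b \<in> scaled_lattice N \<Longrightarrow>
      U a + \<tau> * L a ((b - a) /\<^sub>R \<tau>) \<le> U b + \<tau> * c + \<tau> \<Longrightarrow> norm ((b - a) /\<^sub>R \<tau>) \<le> D"
    and lip: "\<And>x v w. norm v \<le> D + 1 \<Longrightarrow> norm w \<le> D + 1 \<Longrightarrow> L x w - L x v \<le> Q * norm (w - v)"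
    and \<tau>: "0 < \<tau>"
    and ab: "a \<in> scaled_lattice N" "b \<in> scaled_lattice N" "norm (b - a) \<le> \<tau>"
  shows "U b - U a \<le> Q * norm (b - a)"
proof (rule field_le_epsilon)
  fix e :: real assume "0 < e"
  \<comment> \<open>The tolerance is at most \<open>e\<close> for the final estimate and at most
    \<open>\<tau>\<close> for \<open>speed\<close> to apply.\<close>
  with \<tau> obtain z where z: "z \<in> scaled_lattice N"
    "U z + \<tau> * L z ((a - z) /\<^sub>R \<tau>) \<le> U a + \<tau> * c + min e \<tau>"
    using super[OF ab(1), of "min e \<tau>"] by auto
  define v where "v = (a - z) /\<^sub>R \<tau>"
  define w where "w = (b - z) /\<^sub>R \<tau>"
  have v: "norm v \<le> D" unfolding v_def using z by (intro speed ab) auto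
  have wv: "w - v = (b - a) /\<^sub>R \<tau>" by (simp add: v_def w_def algebra_simps)
  have wv': "\<tau> * norm (w - v) = norm (b - a)" using \<tau> by (simp add: wv)
  \<comment> \<open>Moving the endpoint by at most \<open>\<tau>\<close> changes the velocity by at
    most one, hence the radius \<open>D + 1\<close> in \<open>lip\<close>.\<close>
  have "norm (w - v) \<le> 1" using \<tau> ab(3) by (simp add: wv divide_le_eq flip: divide_inverse_commute)
  then have w: "norm w \<le> D + 1" using v norm_triangle_ineq[of v "w - v"] by simp
  have "\<tau> * (L z w - L z v) \<le> \<tau> * (Q * norm (w - v))"
    using \<tau> v w by (intro mult_left_mono lip) auto
  also have "\<dots> = Q * norm (b - a)" by (simp add: wv'[symmetric])
  finally have "\<tau> * L z w - \<tau> * L z v \<le> Q * norm (b - a)" by (simp add: algebra_simps)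
  moreover have "U b + \<tau> * c \<le> U z + \<tau> * L z w" unfolding w_def by (rule sub[OF z(1) ab(2)])
  ultimately show "U b - U a \<le> Q * norm (b - a) + e"
    using z(2) by (simp add: v_def)
qed

section \<open>Periodic extension of grid solutions\<close>

text \<open>A real infimum is a lower bound only for families bounded below. Here \<open>u\<close>
  is bounded on the finite grid and \<open>L\<close> is bounded below.\<close>

lemma lax_oleinik_bdd_below:
  fixes L :: "real ^ 'n \<Rightarrow> real ^ 'n \<Rightarrow> real" and u :: "real ^ 'n \<Rightarrow> real"
  assumes B: "\<And>x v. - B \<le> L x v" and "0 < \<tau>"
  shows "bdd_below ((\<lambda>(x, l). u x + \<tau> * L x ((y + l - x) /\<^sub>R \<tau>)) ` (grid N \<times> int_lattice))"
proof -
  obtain m where m: "\<And>x. x \<in> grid N \<Longrightarrow> m \<le> u x"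
    using finite_imageI[OF finite_grid, THEN bdd_below_finite] by (fastforce simp: bdd_below_def)
  show ?thesis
  proof (rule bdd_belowI2)
    fix z :: "(real ^ 'n) \<times> (real ^ 'n)" assume "z \<in> grid N \<times> int_lattice"
    then show "m + \<tau> * (- B) \<le> (case z of (x, l) \<Rightarrow> u x + \<tau> * L x ((y + l - x) /\<^sub>R \<tau>))"
      using assms m by (cases z) (simp only: case_prod_conv mem_Times_iff fst_conv snd_conv, intro add_mono mult_left_mono, simp_all)
  qed
qed

text \<open>The representative of \<open>a\<close>, with a suitable lattice shift, competes in the
  infimum at that of \<open>b\<close>. For the periodic extension of \<open>u\<close> the shift is
  absorbed into \<open>b - a\<close>.\<close>

lemma grid_solution_subsolution:
  assumes L: "tonelli_lagrangian L" and N: "N \<ge> 1" "0 < \<tau>"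
    and u: "\<And>y. y \<in> grid N \<Longrightarrow> u y + \<tau> * c = lax_oleinik L N \<tau> u y"
    and ab: "a \<in> scaled_lattice N" "b \<in> scaled_lattice N"
  shows "u (frac_vec b) + \<tau> * c \<le> u (frac_vec a) + \<tau> * L a ((b - a) /\<^sub>R \<tau>)"
proof -
  obtain B where "\<And>x v. 0 * norm v - B \<le> L x v"
    using tonelli_lagrangian_superlinear[OF L order_refl] by blast
  then have B: "\<And>x v. - B \<le> L x v" by simp
  define l where "l = (b - frac_vec b) - (a - frac_vec a)"
  have l: "l \<in> int_lattice" by (simp add: l_def int_lattice_diff diff_frac_vec_lattice)
  have "lax_oleinik L N \<tau> u (frac_vec b)
      \<le> u (frac_vec a) + \<tau> * L (frac_vec a) ((frac_vec b + l - frac_vec a) /\<^sub>R \<tau>)"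
    unfolding lax_oleinik_def
    using cINF_lower[OF lax_oleinik_bdd_below[where u=u and y="frac_vec b" and N=N, OF B N(2)], of "(frac_vec a, l)"]
      l frac_vec_in_grid[OF ab(1) N(1)] by simp
  moreover have "L (frac_vec a) = L a"
    using tonelli_lagrangian_add_lattice[OF L diff_frac_vec_lattice[of a], of "frac_vec a"] by simp
  moreover have "frac_vec b + l - frac_vec a = b - a" by (simp add: l_def)
  ultimately show ?thesis using u[OF frac_vec_in_grid[OF ab(2) N(1)]] by simp
qed

text \<open>The reverse inequality up to \<open>e\<close>: a pair nearly realizing the infimum is
  lifted to the scaled lattice.\<close>

lemma grid_solution_almost_minimizer:
  assumes L: "tonelli_lagrangian L" and N: "N \<ge> 1"
    and u: "\<And>y. y \<in> grid N \<Longrightarrow> u y + \<tau> * c = lax_oleinik L N \<tau> u y"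
    and b: "b \<in> scaled_lattice N" and e: "0 < e"
  shows "\<exists>a\<in>scaled_lattice N.
    u (frac_vec a) + \<tau> * L a ((b - a) /\<^sub>R \<tau>) \<le> u (frac_vec b) + \<tau> * c + e"
proof -
  let ?S = "(\<lambda>(x, l). u x + \<tau> * L x ((frac_vec b + l - x) /\<^sub>R \<tau>)) ` (grid N \<times> int_lattice)"
  have less: "Inf ?S < u (frac_vec b) + \<tau> * c + e"
    using u[OF frac_vec_in_grid[OF b N]] e by (simp add: lax_oleinik_def)
  have "?S \<noteq> {}"
    unfolding image_is_empty by (rule grid_times_lattice_nonempty[OF N])
  from cInf_lessD[OF this less] obtain s where "s \<in> ?S" "s < u (frac_vec b) + \<tau> * c + e"
    by (rule bexE)
  then obtain x l where xl: "x \<in> grid N" "l \<in> int_lattice"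
    "u x + \<tau> * L x ((frac_vec b + l - x) /\<^sub>R \<tau>) < u (frac_vec b) + \<tau> * c + e"
    by auto
  \<comment> \<open>Translating \<open>x\<close> by \<open>k\<close> makes its displacement to
    \<open>b\<close> equal to the one from \<open>x\<close> to
    \<open>frac_vec b + l\<close>.\<close>
  define k where "k = (b - frac_vec b) - l"
  have k: "k \<in> int_lattice" using xl(2) by (simp add: k_def int_lattice_diff diff_frac_vec_lattice)
  have frac: "frac_vec (x + k) = x" using frac_vec_add_lattice[OF k] frac_vec_grid[OF xl(1)] by simp
  have diff: "b - (x + k) = frac_vec b + l - x" by (simp add: k_def)
  have "x + k \<in> scaled_lattice N"
    using xl(1) k by (intro scaled_lattice_add subsetD[OF grid_subset_scaled] subsetD[OF int_lattice_subset_scaled])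
  then show ?thesis
    by (rule bexI[rotated])
      (unfold frac diff tonelli_lagrangian_add_lattice[OF L k], rule less_imp_le[OF xl(3)])
qed

text \<open>At a minimum point of \<open>u\<close> every competitor costs at least
  \<open>u y - \<tau> * B\<close>.\<close>

lemma grid_solution_constant_ge:
  fixes L :: "real ^ 'n \<Rightarrow> real ^ 'n \<Rightarrow> real" and u :: "real ^ 'n \<Rightarrow> real"
  assumes N: "N \<ge> 1" "0 < \<tau>" and B: "\<And>x v. - B \<le> L x v"
    and u: "\<And>y. y \<in> grid N \<Longrightarrow> u y + \<tau> * c = lax_oleinik L N \<tau> u y"
  shows "- B \<le> c"
proof -
  have ne: "grid N \<noteq> {}" using grid_zero[OF N(1)] by blast
  obtain y where y: "y \<in> grid N" "\<And>x. x \<in> grid N \<Longrightarrow> u y \<le> u x"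
    using ex_is_arg_min_if_finite[OF finite_grid ne, of u] by (auto simp: is_arg_min_linorder)
  have "u y + \<tau> * (- B) \<le> lax_oleinik L N \<tau> u y"
    unfolding lax_oleinik_def
  proof (rule cINF_greatest)
    show "grid N \<times> (int_lattice :: (real ^ 'n) set) \<noteq> {}"
      by (rule grid_times_lattice_nonempty[OF N(1)])
    fix z :: "(real ^ 'n) \<times> (real ^ 'n)" assume "z \<in> grid N \<times> int_lattice"
    then show "u y + \<tau> * (- B) \<le> (case z of (x, l) \<Rightarrow> u x + \<tau> * L x ((y + l - x) /\<^sub>R \<tau>))"
      using N(2) B y(2) by (cases z) (simp only: case_prod_conv mem_Times_iff fst_conv snd_conv, intro add_mono mult_left_mono, simp_all)
  qed
  then have "\<tau> * (- B) \<le> \<tau> * c" using u[OF y(1)] by simp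
  then show ?thesis using N(2) by (subst (asm) mult_le_cancel_left_pos)
qed

section \<open>Uniform constants, the Lipschitz estimate and the speed bound\<close>

theorem proposition3p2:
  fixes L :: "real ^ 'n \<Rightarrow> real ^ 'n \<Rightarrow> real" and \<tau>\<^sub>0 \<eta>\<^sub>0 :: real
  assumes "tonelli_lagrangian L" and "\<tau>\<^sub>0 > 0" and "\<eta>\<^sub>0 > 0"
  shows "\<exists>C>0. \<exists>D>0. \<forall>(N::nat) (\<tau>::real) (u :: real ^ 'n \<Rightarrow> real).
    N \<ge> 1 \<longrightarrow> 0 < \<tau> \<longrightarrow> \<tau> \<le> \<tau>\<^sub>0 \<longrightarrow> 1 / real N \<le> \<eta>\<^sub>0 * \<tau> \<longrightarrow>
    (\<forall>y\<in>grid N. u y + \<tau> * Lbar L N \<tau> = lax_oleinik L N \<tau> u y) \<longrightarrow>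
      (\<forall>x\<in>grid N. \<forall>y\<in>grid N. \<bar>u x - u y\<bar> \<le> C * torus_dist x y) \<and>
      (\<forall>y\<in>grid N. \<forall>x\<in>grid N. \<forall>l\<in>int_lattice.
        u y + \<tau> * Lbar L N \<tau> = u x + \<tau> * L x ((y + l - x) /\<^sub>R \<tau>) \<longrightarrow>
        norm ((y + l - x) /\<^sub>R \<tau>) \<le> D)"
proof -
  note L = assms(1)
  \<comment> \<open>The radius is the largest speed of a step in the rounded chains.\<close>
  obtain A where A: "\<And>x v. norm v \<le> 1 + real CARD('n) * \<eta>\<^sub>0 \<Longrightarrow> L x v \<le> A"
    using tonelli_lagrangian_upper[OF L] by blast
  obtain B where "\<And>x v. 0 * norm v - B \<le> L x v"
    using tonelli_lagrangian_superlinear[OF L order_refl] by blast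
  then have B: "\<And>x v. - B \<le> L x v" by simp
  have L0: "L x 0 \<le> A" for x using A[of 0 x] assms(3) by simp
  define M where "M = A + B"
  have M: "M \<ge> 0" using L0[of 0] B[of 0 0] by (simp add: M_def)
  \<comment> \<open>The slope exceeds the coarse Lipschitz constant \<open>2 * M\<close> by
    one.\<close>
  obtain B' where B': "\<And>x v. (2 * M + 1) * norm v - B' \<le> L x v"
    using tonelli_lagrangian_superlinear[OF L, of "2 * M + 1"] M by auto
  define D where "D = max 1 (A + B' + 1)"
  \<comment> \<open>\<open>D\<close> is fixed before \<open>Q\<close>, because the Lipschitz
    constant of \<open>L\<close> is taken on the ball of radius \<open>D + 1\<close>.\<close>
  obtain Q where Q: "Q \<ge> 0"
    "\<And>x v w. norm v \<le> D + 1 \<Longrightarrow> norm w \<le> D + 1 \<Longrightarrow> L x w - L x v \<le> Q * norm (w - v)"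
    using tonelli_lagrangian_lipschitz[OF L] by metis
  \<comment> \<open>The summand 1 makes \<open>C\<close> positive even when \<open>M\<close> and
    \<open>Q\<close> vanish.\<close>
  define C where "C = 2 * M + Q + 1"
  have C: "C > 0" "2 * M \<le> C" "Q \<le> C" using M Q(1) by (auto simp: C_def)
  show ?thesis
  proof (rule exI[of _ C], rule conjI, rule C(1), rule exI[of _ D], intro conjI allI impI ballI)
    show "D > 0" by (simp add: D_def)
  next
    fix N :: nat and \<tau> and u :: "real ^ 'n \<Rightarrow> real"
    assume "\<tau> \<le> \<tau>\<^sub>0"
      and N: "N \<ge> 1" "0 < \<tau>" "1 / real N \<le> \<eta>\<^sub>0 * \<tau>"
      and "\<forall>y\<in>grid N. u y + \<tau> * Lbar L N \<tau> = lax_oleinik L N \<tau> u y"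
    then have u: "\<And>y. y \<in> grid N \<Longrightarrow> u y + \<tau> * Lbar L N \<tau> = lax_oleinik L N \<tau> u y" by blast
    define c where "c = Lbar L N \<tau>"
    define U where "U = (\<lambda>z. u (frac_vec z))"
    have sub: "U b + \<tau> * c \<le> U a + \<tau> * L a ((b - a) /\<^sub>R \<tau>)"
      if "a \<in> scaled_lattice N" "b \<in> scaled_lattice N" for a b
      unfolding U_def c_def by (rule grid_solution_subsolution[OF L N(1,2) u that])
    have super: "\<exists>a\<in>scaled_lattice N. U a + \<tau> * L a ((b - a) /\<^sub>R \<tau>) \<le> U b + \<tau> * c + e"
      if "b \<in> scaled_lattice N" "0 < e" for b e
      unfolding U_def c_def by (rule grid_solution_almost_minimizer[OF L N(1) u that])
    have "- B \<le> c" unfolding c_def by (rule grid_solution_constant_ge[OF N(1,2) B u])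
    moreover have "c \<le> A"
    proof -
      \<comment> \<open>Standing still at the origin: with equal endpoints the values of
        \<open>U\<close> cancel.\<close>
      have "0 \<in> scaled_lattice N" by (simp add: scaled_lattice_def)
      from sub[OF this this] have "\<tau> * c \<le> \<tau> * L 0 0" by simp
      then show ?thesis using L0[of 0] N(2) by simp
    qed
    ultimately have c: "- B \<le> c" "c \<le> A" by auto
    have cost: "L x v - c \<le> M" if "norm v \<le> 1 + real CARD('n) * \<eta>\<^sub>0" for x v
      using A[OF that, of x] c(1) by (simp add: M_def)
    have coarse: "U b - U a \<le> 2 * M * norm (b - a)"
      if "a \<in> scaled_lattice N" "b \<in> scaled_lattice N" "\<tau> \<le> norm (b - a)" for a b
      by (rule subsolution_coarse_lipschitz[where U=U and L=L and c=c, OF sub cost M N that])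
    have speed: "norm ((b - a) /\<^sub>R \<tau>) \<le> D"
      if "a \<in> scaled_lattice N" "b \<in> scaled_lattice N"
        "U a + \<tau> * L a ((b - a) /\<^sub>R \<tau>) \<le> U b + \<tau> * c + \<tau>" for a b
      unfolding D_def by (rule minimizer_speed_bound[where U=U and L=L and c=c and K="2 * M", OF coarse[OF that(1,2)] B' N(2) c(2) that(3)])
    have lipschitz: "U b - U a \<le> C * norm (b - a)"
      if ab: "a \<in> scaled_lattice N" "b \<in> scaled_lattice N" for a b
    proof (cases "\<tau> \<le> norm (b - a)")
      case True
      then show ?thesis
        using coarse[OF ab True] mult_right_mono[OF C(2) norm_ge_zero, of "b - a"] by linarith
    next
      case False
      then have "U b - U a \<le> Q * norm (b - a)"
        by (intro solution_fine_lipschitz[where U=U and L=L and c=c and D=D, OF sub super speed Q(2) N(2) ab]) auto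
      then show ?thesis using mult_right_mono[OF C(3) norm_ge_zero, of "b - a"] by linarith
    qed
    have grid: "x \<in> scaled_lattice N" "U x = u x" if "x \<in> grid N" for x
      using that by (auto simp: U_def frac_vec_grid intro: subsetD[OF grid_subset_scaled])
    have translate: "y + l \<in> scaled_lattice N" "U (y + l) = u y" if "y \<in> grid N" "l \<in> int_lattice" for y l
      using that by (auto simp: U_def frac_vec_add_lattice frac_vec_grid
          intro!: scaled_lattice_add intro: grid(1) subsetD[OF int_lattice_subset_scaled])
    {
      fix x y :: "real ^ 'n" assume xy: "x \<in> grid N" "y \<in> grid N"
      \<comment> \<open>Each lattice translate of \<open>y\<close> has the same value of
        \<open>U\<close>, so the bound holds for every \<open>l\<close> and passes to the
        infimum.\<close>
      have "\<bar>u x - u y\<bar> / C \<le> dist x (y + l)" if l: "l \<in> int_lattice" for l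
        using lipschitz[OF grid(1)[OF xy(1)] translate(1)[OF xy(2) l]]
          lipschitz[OF translate(1)[OF xy(2) l] grid(1)[OF xy(1)]] C(1)
        unfolding translate(2)[OF xy(2) l] grid(2)[OF xy(1)]
        by (simp add: dist_norm norm_minus_commute divide_le_eq mult.commute abs_le_iff)
      then have "\<bar>u x - u y\<bar> / C \<le> torus_dist x y"
        unfolding torus_dist_def using int_lattice_zero by (intro cINF_greatest) auto
      then show "\<bar>u x - u y\<bar> \<le> C * torus_dist x y" using C(1) by (simp add: divide_le_eq mult.commute)
    next
      fix x y l :: "real ^ 'n"
      assume *: "y \<in> grid N" "x \<in> grid N" "l \<in> int_lattice"
        "u y + \<tau> * Lbar L N \<tau> = u x + \<tau> * L x ((y + l - x) /\<^sub>R \<tau>)"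
      show "norm ((y + l - x) /\<^sub>R \<tau>) \<le> D"
        \<comment> \<open>An exact minimizer satisfies the hypothesis of \<open>speed\<close> with
          slack \<open>\<tau>\<close> to spare.\<close>
        using * N(2) by (intro speed grid translate) (simp_all add: grid translate c_def)
    }
  qed
qed

end
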